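(* Let $\mathcal{T}$ be a TBox and $\Sigma\subseteq\mathrm{sig}(\mathcal{T})$ a signature. For each $z\in\{\mathsf m,\mathsf q,\mathsf f,\mathsf i,\mathsf c\}$, the module $\mathcal{M}^{\chi_z}$ of the setting $\chi_z$ for $\mathcal{T}$ and $\Sigma$ defined in the context is depleting (with respect to $\equiv^z_\Sigma$); that is, $\mathcal{M}^{\chi_z}$ is a $\equiv^z_\Sigma$-module of $\mathcal{T}$ and $\mathcal{T}\setminus\mathcal{M}^{\chi_z}\equiv^z_\Sigma\emptyset$.
   Context: Rules and TBoxes. Standard first-order logic is used. A signature is a set of predicates; $\mathrm{sig}(F)$ is the signature of a set of formulas $F$; the nullary falsehood predicate $\bot$ is assumed to belong to every signature. A rule is a function-free sentence $\forall\mathbf{x}.[\varphi(\mathbf{x})\to\exists\mathbf{y}.[\bigvee_{i=1}^n\psi_i(\mathbf{x},\mathbf{y})]]$ with the body $\varphi$ and the $\psi_i$ conjunctions of distinct atoms ($n\ge 0$; for $n=0$ the head is the empty disjunction, i.e. $\bot$). Rules are safe (all universally quantified variables in the head occur in the body), and w.l.o.g. the truth symbol $\top$ does not occur in rule heads and $\bot$ does not occur in rule bodies. Universal quantifiers are usually omitted. A TBox is a finite set of rules; TBoxes mentioning equality are extended with its standard axiomatisation. A fact is a function-free ground atom; an ABox is a finite set of facts; a $\Sigma$-ABox is an ABox over the predicates of $\Sigma$. A positive existential query is a formula $\exists\mathbf{y}.\varphi(\mathbf{x},\mathbf{y})$ with $\varphi$ built from function-free atoms using only $\wedge$ and $\vee$;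 it is Boolean if it has no free variables. Standing assumptions: $\mathcal{T}$ contains no constants and rules in $\mathcal{T}$ do not share existentially quantified variables. Inseparability relations between TBoxes $\mathcal{T}_1,\mathcal{T}_2$. - $\mathcal{T}_1\equiv^{\mathsf m}_\Sigma\mathcal{T}_2$: for every model $\mathcal{I}$ of $\mathcal{T}_1$ (resp. of $\mathcal{T}_2$) there is a model $\mathcal{J}$ of $\mathcal{T}_2$ (resp. of $\mathcal{T}_1$) with the same domain such that $A^{\mathcal{I}}=A^{\mathcal{J}}$ for each $A\in\Sigma$. - $\mathcal{T}_1\equiv^{\mathsf q}_\Sigma\mathcal{T}_2$: for every Boolean positive existential query $q$ over $\Sigma$ and $\Sigma$-ABox $\mathcal{A}$, $\mathcal{T}_1\cup\mathcal{A}\models q$ iff $\mathcal{T}_2\cup\mathcal{A}\models q$. - $\mathcal{T}_1\equiv^{\mathsf f}_\Sigma\mathcal{T}_2$: for every fact $\gamma$ and ABox $\mathcal{A}$ over $\Sigma$, $\mathcal{T}_1\cup\mathcal{A}\models\gamma$ iff $\mathcal{T}_2\cup\mathcal{A}\models\gamma$. - $\mathcal{T}_1\equiv^{\mathsf i}_\Sigma\mathcal{T}_2$: for each $\varphi$ of the form $A(\mathbf{x})\to B(\mathbf{x})$ with $A,B\in\Sigma$, $\mathcal{T}_1\models\varphi$ iff $\mathcal{T}_2\models\varphi$. - $\mathcal{T}_1\equiv^{\mathsf c}_\Sigma\mathcal{T}_2$: for each $\varphi$ of the form $A(\mathbf{x})\to B(\mathbf{x})$ with $A\in\Sigma$ and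 $B\in\mathrm{sig}(\mathcal{T}_1\cup\mathcal{T}_2)$, $\mathcal{T}_1\models\varphi$ iff $\mathcal{T}_2\models\varphi$. In $A(\mathbf{x})\to B(\mathbf{x})$, $\mathbf{x}$ is a tuple of (w.l.o.g. pairwise distinct) universally quantified variables. A $\equiv$-module of $\mathcal{T}$ is a subset $\mathcal{M}\subseteq\mathcal{T}$ with $\mathcal{T}\equiv\mathcal{M}$. Datalog. A rule is datalog if its head has at most one atom and all variables are universally quantified; a datalog program $\mathcal{P}$ is a set of datalog rules. A fact $\gamma$ is a consequence of a datalog rule $\bigwedge_{i=1}^n\gamma_i'\to\delta$ and facts $\gamma_1,\dots,\gamma_n$ if $\gamma=\delta\sigma$ with $\sigma$ a most general unifier of $\gamma_i,\gamma_i'$ for each $1\le i\le n$. A proof of $\gamma$ in $\mathcal{P}\cup\mathcal{A}$ ($\mathcal{A}$ an ABox) is a pair $(T,\lambda)$ with $T$ a tree and $\lambda$ mapping nodes of $T$ to facts and edges of $T$ to rules of $\mathcal{P}$, such that for each node $v$: (1) $\lambda(v)=\gamma$ if $v$ is the root; (2) $\lambda(v)\in\mathcal{A}$ if $v$ is a leaf; (3) if $v$ has children $w_1,\dots,w_n$, then all edges from $v$ to the $w_i$ are labelled by the same rule $r$ and $\lambda(v)$ is a consequence of $r$ and $\lambda(w_1),\dots,\lambda(w_n)$. The support of $\gamma$ is the set of rules occurring in some proof of $\gamma$ in $\mathcal{P}\cup\mathcal{A}$. Module settings. A module setting for $\mathcal{T}$ and $\Sigma$ is a tuple $\chi=\langle\theta,\mathcal{A}_0,\mathcal{A}_r\rangle$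 with $\theta$ a substitution from the existentially quantified variables of $\mathcal{T}$ to constants, $\mathcal{A}_0$ a $\Sigma$-ABox, $\mathcal{A}_r$ a $\mathrm{sig}(\mathcal{T})$-ABox, and such that no constant in $\chi$ occurs in $\mathcal{T}$. The program $\mathcal{P}^\chi$ is the smallest datalog program containing, for each rule $\varphi(\mathbf{x})\to\exists\mathbf{y}.[\bigvee_{i=1}^n\psi_i(\mathbf{x},\mathbf{y})]$ in $\mathcal{T}$, the following corresponding datalog rules: $\varphi\to\bot$ if $n=0$, and $\varphi\to\gamma\theta$ for each $1\le i\le n$ and each atom $\gamma$ in $\psi_i$. The support of $\chi$ is the set of rules of $\mathcal{P}^\chi$ that support a fact from $\mathcal{A}_r$ in $\mathcal{P}^\chi\cup\mathcal{A}_0$. The module $\mathcal{M}^\chi$ is the set of rules in $\mathcal{T}$ that have a corresponding datalog rule in the support of $\chi$. The settings $\chi_z=\langle\theta^z,\mathcal{A}_0^z,\mathcal{A}_r^z\rangle$. Let $c_y$ (for each existentially quantified variable $y$ in $\mathcal{T}$), $c_A^1,\dots,c_A^n$ (for each $A\in\Sigma$ of arity $n$) and $\ast$ be fresh constants. - $\theta^{\mathsf i}=\theta^{\mathsf c}=\theta^{\mathsf f}=\theta^{\mathsf q}=\{y\mapsto c_y\mid y\text{ existentially quantified in }\mathcal{T}\}$; $\theta^{\mathsf m}$ maps every such $y$ to $\ast$. - $\mathcal{A}_0^{\mathsf i}=\mathcal{A}_0^{\mathsf c}=\{A(c_A^1,\dots,c_A^n)\mid A\ n\text{-ary predicate in }\Sigma\}$;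 $\mathcal{A}_0^{\mathsf f}=\mathcal{A}_0^{\mathsf q}=\mathcal{A}_0^{\mathsf m}=\{A(\ast,\dots,\ast)\mid A\in\Sigma\}$. - $\mathcal{A}_r^{\mathsf i}=\{B(c_A^1,\dots,c_A^n)\mid A\ne B\ n\text{-ary predicates in }\Sigma\}$; $\mathcal{A}_r^{\mathsf c}$ consists of all facts $B(c_A^1,\dots,c_A^n)$ such that $A\ne B$ are $n$-ary predicates, $A\in\Sigma$ and $B\in\mathrm{sig}(\mathcal{T})$; $\mathcal{A}_r^{\mathsf f}=\mathcal{A}_r^{\mathsf m}=\mathcal{A}_0^{\mathsf f}$; $\mathcal{A}_r^{\mathsf q}$ consists of all $\Sigma$-facts $A(a_1,\dots,a_n)$ with each $a_j$ either a constant $c_y$ or $\ast$.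
   Formalization: For z = i and z = c, ⊥ is admitted as B for predicates A of every arity: implications A(x)→⊥ count in the relations, and ⊥ is added to A_r whenever Σ has a predicate other than ⊥; with equal arities only, the claim fails. *)

theory Defs
  imports Main
begin

section \<open>Syntax\<close>

text \<open>
  A predicate symbol is a name together with its arity. \<open>Bot\<close> is the nullary falsehood
  predicate. Equality is not built in: it is an ordinary binary predicate symbol, and a TBox
  mentioning it is one whose finite set of rules already contains the rules that axiomatise it.
\<close>

datatype 'p pred = Bot | Pred 'p nat

fun arity :: "'p pred \<Rightarrow> nat" where
  "arity Bot = 0"
| "arity (Pred p n) = n"

datatype ('v, 'c) trm = Var 'v | Cst 'c

fun trm_vars :: "('v, 'c) trm \<Rightarrow> 'v set" where
  "trm_vars (Var x) = {x}"
| "trm_vars (Cst c) = {}"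

fun trm_consts :: "('v, 'c) trm \<Rightarrow> 'c set" where
  "trm_consts (Var x) = {}"
| "trm_consts (Cst c) = {c}"

fun trm_subst :: "('v, 'c) trm \<Rightarrow> ('v \<Rightarrow> ('v, 'c) trm) \<Rightarrow> ('v, 'c) trm" where
  "trm_subst (Var x) \<sigma> = \<sigma> x"
| "trm_subst (Cst c) \<sigma> = Cst c"

text \<open>
  Atoms are parametrised by their type of arguments: \<open>('v, 'c) trm\<close> for function-free atoms,
  \<open>'c\<close> for facts.
\<close>

datatype (dead 'p, 't) atom = Atom (psym: "'p pred") (args: "'t list")

type_synonym ('p, 'v, 'c) fatom = "('p, ('v, 'c) trm) atom"
type_synonym ('p, 'c) fact = "('p, 'c) atom"

definition wf_atom :: "('p, 't) atom \<Rightarrow> bool" where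
  "wf_atom a \<longleftrightarrow> length (args a) = arity (psym a)"

definition atom_vars :: "('p, 'v, 'c) fatom \<Rightarrow> 'v set" where
  "atom_vars a = (\<Union>t\<in>set (args a). trm_vars t)"

definition atom_consts :: "('p, 'v, 'c) fatom \<Rightarrow> 'c set" where
  "atom_consts a = (\<Union>t\<in>set (args a). trm_consts t)"

definition atom_subst ::
    "('p, 'v, 'c) fatom \<Rightarrow> ('v \<Rightarrow> ('v, 'c) trm) \<Rightarrow> ('p, 'v, 'c) fatom" where
  "atom_subst a \<sigma> = map_atom (\<lambda>t. trm_subst t \<sigma>) a"

definition ground :: "('p, 'c) fact \<Rightarrow> ('p, 'v, 'c) fatom" where
  "ground \<gamma> = map_atom Cst \<gamma>"

text \<open>
  A rule stands for the sentence "for all x, if \<open>body\<close> then there are \<open>exs\<close> such that one of the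
  conjunctions in \<open>heads\<close> holds", where the universal quantifiers range over all variables not in
  \<open>exs\<close>. An empty body is the truth symbol, an empty list of heads is falsehood.
\<close>

record ('p, 'v, 'c) rule =
  body  :: "('p, 'v, 'c) fatom list"
  exs   :: "'v list"
  heads :: "('p, 'v, 'c) fatom list list"

definition head_atoms :: "('p, 'v, 'c) rule \<Rightarrow> ('p, 'v, 'c) fatom set" where
  "head_atoms r = (\<Union>\<psi>\<in>set (heads r). set \<psi>)"

definition rule_atoms :: "('p, 'v, 'c) rule \<Rightarrow> ('p, 'v, 'c) fatom set" where
  "rule_atoms r = set (body r) \<union> head_atoms r"

definition body_vars :: "('p, 'v, 'c) rule \<Rightarrow> 'v set" where
  "body_vars r = (\<Union>a\<in>set (body r). atom_vars a)"

definition head_vars :: "('p, 'v, 'c) rule \<Rightarrow> 'v set" where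
  "head_vars r = (\<Union>a\<in>head_atoms r. atom_vars a)"

text \<open>
  The truth symbol does not occur in heads, so every \<open>\<psi>\<close> is non-empty. The last conjunct is
  safety.
\<close>

definition wf_rule :: "('p, 'v, 'c) rule \<Rightarrow> bool" where
  "wf_rule r \<longleftrightarrow>
     (\<forall>a\<in>rule_atoms r. wf_atom a) \<and>
     distinct (body r) \<and>
     (\<forall>\<psi>\<in>set (heads r). \<psi> \<noteq> [] \<and> distinct \<psi>) \<and>
     Bot \<notin> psym ` set (body r) \<and>
     set (exs r) \<inter> body_vars r = {} \<and>
     head_vars r - set (exs r) \<subseteq> body_vars r"

definition sig :: "('p, 'v, 'c) rule set \<Rightarrow> 'p pred set" where
  "sig T = insert Bot (\<Union>r\<in>T. psym ` rule_atoms r)"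

definition ex_vars :: "('p, 'v, 'c) rule set \<Rightarrow> 'v set" where
  "ex_vars T = (\<Union>r\<in>T. set (exs r))"

definition tbox_consts :: "('p, 'v, 'c) rule set \<Rightarrow> 'c set" where
  "tbox_consts T = (\<Union>r\<in>T. \<Union>a\<in>rule_atoms r. atom_consts a)"

definition tbox :: "('p, 'v, 'c) rule set \<Rightarrow> bool" where
  "tbox T \<longleftrightarrow>
     finite T \<and>
     (\<forall>r\<in>T. wf_rule r) \<and>
     tbox_consts T = {} \<and>
     (\<forall>r\<in>T. \<forall>r'\<in>T. r \<noteq> r' \<longrightarrow> set (exs r) \<inter> set (exs r') = {})"

definition fact_over :: "'p pred set \<Rightarrow> ('p, 'c) fact \<Rightarrow> bool" where
  "fact_over \<Sigma> \<gamma> \<longleftrightarrow> wf_atom \<gamma> \<and> psym \<gamma> \<in> \<Sigma>"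

definition abox :: "'p pred set \<Rightarrow> ('p, 'c) fact set \<Rightarrow> bool" where
  "abox \<Sigma> A \<longleftrightarrow> finite A \<and> (\<forall>\<gamma>\<in>A. fact_over \<Sigma> \<gamma>)"

text \<open>The quantifier-free part of a positive existential query.\<close>

datatype ('p, 'v, 'c) pos =
    PAtom "('p, 'v, 'c) fatom"
  | PAnd "('p, 'v, 'c) pos" "('p, 'v, 'c) pos"
  | POr "('p, 'v, 'c) pos" "('p, 'v, 'c) pos"

fun pos_atoms :: "('p, 'v, 'c) pos \<Rightarrow> ('p, 'v, 'c) fatom set" where
  "pos_atoms (PAtom a) = {a}"
| "pos_atoms (PAnd \<phi> \<psi>) = pos_atoms \<phi> \<union> pos_atoms \<psi>"
| "pos_atoms (POr \<phi> \<psi>) = pos_atoms \<phi> \<union> pos_atoms \<psi>"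

datatype ('p, 'v, 'c) query = Query (qvars: "'v list") (qpos: "('p, 'v, 'c) pos")

definition query_over :: "'p pred set \<Rightarrow> ('p, 'v, 'c) query \<Rightarrow> bool" where
  "query_over \<Sigma> q \<longleftrightarrow> (\<forall>a\<in>pos_atoms (qpos q). wf_atom a \<and> psym a \<in> \<Sigma>)"

definition boolean_query :: "('p, 'v, 'c) query \<Rightarrow> bool" where
  "boolean_query q \<longleftrightarrow> (\<Union>a\<in>pos_atoms (qpos q). atom_vars a) \<subseteq> set (qvars q)"

section \<open>Semantics\<close>

record ('p, 'c, 'd) interp =
  dmn  :: "'d set"
  pint :: "'p pred \<Rightarrow> 'd list set"
  cint :: "'c \<Rightarrow> 'd"

definition is_interp :: "('p, 'c, 'd) interp \<Rightarrow> bool" where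
  "is_interp I \<longleftrightarrow>
     dmn I \<noteq> {} \<and>
     (\<forall>P. pint I P \<subseteq> {ds. set ds \<subseteq> dmn I \<and> length ds = arity P}) \<and>
     pint I Bot = {} \<and>
     range (cint I) \<subseteq> dmn I"

fun trm_val :: "('p, 'c, 'd) interp \<Rightarrow> ('v \<Rightarrow> 'd) \<Rightarrow> ('v, 'c) trm \<Rightarrow> 'd" where
  "trm_val I v (Var x) = v x"
| "trm_val I v (Cst c) = cint I c"

definition sat_atom :: "('p, 'c, 'd) interp \<Rightarrow> ('v \<Rightarrow> 'd) \<Rightarrow> ('p, 'v, 'c) fatom \<Rightarrow> bool" where
  "sat_atom I v a \<longleftrightarrow> map (trm_val I v) (args a) \<in> pint I (psym a)"

definition ex_variant ::
    "('p, 'c, 'd) interp \<Rightarrow> 'v list \<Rightarrow> ('v \<Rightarrow> 'd) \<Rightarrow> ('v \<Rightarrow> 'd) \<Rightarrow> bool" where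
  "ex_variant I ys v w \<longleftrightarrow> range w \<subseteq> dmn I \<and> (\<forall>x. x \<notin> set ys \<longrightarrow> w x = v x)"

definition sat_rule :: "('p, 'c, 'd) interp \<Rightarrow> ('p, 'v, 'c) rule \<Rightarrow> bool" where
  "sat_rule I r \<longleftrightarrow>
     (\<forall>v. range v \<subseteq> dmn I \<longrightarrow> (\<forall>a\<in>set (body r). sat_atom I v a) \<longrightarrow>
        (\<exists>w. ex_variant I (exs r) v w \<and> (\<exists>\<psi>\<in>set (heads r). \<forall>a\<in>set \<psi>. sat_atom I w a)))"

definition sat_fact :: "('p, 'c, 'd) interp \<Rightarrow> ('p, 'c) fact \<Rightarrow> bool" where
  "sat_fact I \<gamma> \<longleftrightarrow> map (cint I) (args \<gamma>) \<in> pint I (psym \<gamma>)"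

fun sat_pos :: "('p, 'c, 'd) interp \<Rightarrow> ('v \<Rightarrow> 'd) \<Rightarrow> ('p, 'v, 'c) pos \<Rightarrow> bool" where
  "sat_pos I v (PAtom a) = sat_atom I v a"
| "sat_pos I v (PAnd \<phi> \<psi>) = (sat_pos I v \<phi> \<and> sat_pos I v \<psi>)"
| "sat_pos I v (POr \<phi> \<psi>) = (sat_pos I v \<phi> \<or> sat_pos I v \<psi>)"

definition sat_query :: "('p, 'c, 'd) interp \<Rightarrow> ('p, 'v, 'c) query \<Rightarrow> bool" where
  "sat_query I q \<longleftrightarrow>
     (\<forall>v. range v \<subseteq> dmn I \<longrightarrow> (\<exists>w. ex_variant I (qvars q) v w \<and> sat_pos I w (qpos q)))"

datatype ('p, 'v, 'c) sentence =
    RuleS "('p, 'v, 'c) rule"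
  | FactS "('p, 'c) fact"
  | QueryS "('p, 'v, 'c) query"

fun sat :: "('p, 'c, 'd) interp \<Rightarrow> ('p, 'v, 'c) sentence \<Rightarrow> bool" where
  "sat I (RuleS r) = sat_rule I r"
| "sat I (FactS \<gamma>) = sat_fact I \<gamma>"
| "sat I (QueryS q) = sat_query I q"

definition model :: "('p, 'c, 'd) interp \<Rightarrow> ('p, 'v, 'c) sentence set \<Rightarrow> bool" where
  "model I F \<longleftrightarrow> is_interp I \<and> (\<forall>s\<in>F. sat I s)"

text \<open>
  Interpretations have arbitrary non-empty domains contained in the type \<open>'d\<close>. Only finite sets
  of sentences without built-in equality are considered, so by the Loewenheim-Skolem theorem this
  is first-order entailment whenever \<open>'d\<close> is infinite. For finite \<open>'d\<close> it is not.
\<close>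

definition entails ::
    "'d itself \<Rightarrow> ('p, 'v, 'c) sentence set \<Rightarrow> ('p, 'v, 'c) sentence \<Rightarrow> bool" where
  "entails _ F s \<longleftrightarrow> (\<forall>I :: ('p, 'c, 'd) interp. model I F \<longrightarrow> sat I s)"

section \<open>Inseparability and depleting modules\<close>

text \<open>
  \<open>papp B ts\<close> is the atom \<open>B(ts)\<close>, with \<open>Bot(ts)\<close> read as \<open>Bot\<close>. In implications \<open>A(x) \<rightarrow> B(x)\<close>,
  and in the facts \<open>B(c)\<close> that represent them, falsehood is a possible choice of \<open>B\<close> for \<open>A\<close> of any
  arity: unsatisfiability of \<open>A\<close> is the implication \<open>A(x) \<rightarrow> Bot\<close>. Without this reading, if
  \<open>\<Sigma>\<close> consists of \<open>Bot\<close> and unary predicates, the modules for the two implication-based relations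
  could miss a rule \<open>A(x) \<rightarrow> Bot\<close>, although it entails \<open>A(x) \<rightarrow> B(x)\<close> for every unary \<open>B\<close>, and
  would then not be depleting.
\<close>

definition papp :: "'p pred \<Rightarrow> 't list \<Rightarrow> ('p, 't) atom" where
  "papp B ts = Atom B (if B = Bot then [] else ts)"

definition comparable :: "'p pred \<Rightarrow> 'p pred \<Rightarrow> bool" where
  "comparable A B \<longleftrightarrow> arity B = arity A \<or> B = Bot"

definition implication :: "'p pred \<Rightarrow> 'p pred \<Rightarrow> 'v list \<Rightarrow> ('p, 'v, 'c) rule" where
  "implication A B xs =
     \<lparr>body = [papp A (map Var xs)], exs = [], heads = [[papp B (map Var xs)]]\<rparr>"

definition same_implications ::
    "'d itself \<Rightarrow> 'p pred set \<Rightarrow> 'p pred set \<Rightarrow>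
     ('p, 'v, 'c) rule set \<Rightarrow> ('p, 'v, 'c) rule set \<Rightarrow> bool" where
  "same_implications D \<Sigma>\<^sub>A \<Sigma>\<^sub>B T\<^sub>1 T\<^sub>2 \<longleftrightarrow>
     (\<forall>A\<in>\<Sigma>\<^sub>A. \<forall>B\<in>\<Sigma>\<^sub>B. \<forall>xs. comparable A B \<and> distinct xs \<and> length xs = arity A \<longrightarrow>
        (entails D (RuleS ` T\<^sub>1) (RuleS (implication A B xs)) \<longleftrightarrow>
         entails D (RuleS ` T\<^sub>2) (RuleS (implication A B xs))))"

definition models_extend ::
    "'d itself \<Rightarrow> 'p pred set \<Rightarrow> ('p, 'v, 'c) rule set \<Rightarrow> ('p, 'v, 'c) rule set \<Rightarrow> bool" where
  "models_extend _ \<Sigma> T\<^sub>1 T\<^sub>2 \<longleftrightarrow>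
     (\<forall>I :: ('p, 'c, 'd) interp. model I (RuleS ` T\<^sub>1) \<longrightarrow>
        (\<exists>J :: ('p, 'c, 'd) interp. model J (RuleS ` T\<^sub>2) \<and> dmn J = dmn I \<and>
           (\<forall>A\<in>\<Sigma>. pint I A = pint J A)))"

datatype kind = Kind_m | Kind_q | Kind_f | Kind_i | Kind_c

fun insep ::
    "'d itself \<Rightarrow> kind \<Rightarrow> 'p pred set \<Rightarrow>
     ('p, 'v, 'c) rule set \<Rightarrow> ('p, 'v, 'c) rule set \<Rightarrow> bool" where
  "insep D Kind_m \<Sigma> T\<^sub>1 T\<^sub>2 \<longleftrightarrow> models_extend D \<Sigma> T\<^sub>1 T\<^sub>2 \<and> models_extend D \<Sigma> T\<^sub>2 T\<^sub>1"
| "insep D Kind_q \<Sigma> T\<^sub>1 T\<^sub>2 \<longleftrightarrow>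
     (\<forall>Q A. query_over \<Sigma> Q \<and> boolean_query Q \<and> abox \<Sigma> A \<longrightarrow>
        (entails D (RuleS ` T\<^sub>1 \<union> FactS ` A) (QueryS Q) \<longleftrightarrow>
         entails D (RuleS ` T\<^sub>2 \<union> FactS ` A) (QueryS Q)))"
| "insep D Kind_f \<Sigma> T\<^sub>1 T\<^sub>2 \<longleftrightarrow>
     (\<forall>\<gamma> A. fact_over \<Sigma> \<gamma> \<and> abox \<Sigma> A \<longrightarrow>
        (entails D (RuleS ` T\<^sub>1 \<union> FactS ` A) (FactS \<gamma>) \<longleftrightarrow>
         entails D (RuleS ` T\<^sub>2 \<union> FactS ` A) (FactS \<gamma>)))"
| "insep D Kind_i \<Sigma> T\<^sub>1 T\<^sub>2 \<longleftrightarrow> same_implications D \<Sigma> \<Sigma> T\<^sub>1 T\<^sub>2"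
| "insep D Kind_c \<Sigma> T\<^sub>1 T\<^sub>2 \<longleftrightarrow> same_implications D \<Sigma> (sig (T\<^sub>1 \<union> T\<^sub>2)) T\<^sub>1 T\<^sub>2"

definition is_module :: "('r set \<Rightarrow> 'r set \<Rightarrow> bool) \<Rightarrow> 'r set \<Rightarrow> 'r set \<Rightarrow> bool" where
  "is_module R T M \<longleftrightarrow> M \<subseteq> T \<and> R T M"

definition depleting :: "('r set \<Rightarrow> 'r set \<Rightarrow> bool) \<Rightarrow> 'r set \<Rightarrow> 'r set \<Rightarrow> bool" where
  "depleting R T M \<longleftrightarrow> is_module R T M \<and> R (T - M) {}"

section \<open>Datalog\<close>

datatype ('p, 'v, 'c) drule = DRule "('p, 'v, 'c) fatom list" "('p, 'v, 'c) fatom"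

type_synonym ('p, 'v, 'c) eqs = "(('p, 'v, 'c) fatom \<times> ('p, 'v, 'c) fatom) set"

definition unifier :: "('p, 'v, 'c) eqs \<Rightarrow> ('v \<Rightarrow> ('v, 'c) trm) \<Rightarrow> bool" where
  "unifier E \<sigma> \<longleftrightarrow> (\<forall>(a, b)\<in>E. atom_subst a \<sigma> = atom_subst b \<sigma>)"

definition mgu :: "('p, 'v, 'c) eqs \<Rightarrow> ('v \<Rightarrow> ('v, 'c) trm) \<Rightarrow> bool" where
  "mgu E \<sigma> \<longleftrightarrow> unifier E \<sigma> \<and> (\<forall>\<tau>. unifier E \<tau> \<longrightarrow> (\<exists>\<rho>. \<forall>x. \<tau> x = trm_subst (\<sigma> x) \<rho>))"

fun consequence ::
    "('p, 'v, 'c) drule \<Rightarrow> ('p, 'c) fact list \<Rightarrow> ('p, 'c) fact \<Rightarrow> bool" where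
  "consequence (DRule bs \<delta>) \<gamma>s \<gamma> \<longleftrightarrow>
     length \<gamma>s = length bs \<and>
     (\<exists>\<sigma>. mgu (set (zip (map ground \<gamma>s) bs)) \<sigma> \<and> ground \<gamma> = atom_subst \<delta> \<sigma>)"

text \<open>
  The rule labelling all edges from an inner node to its children is stored at that node. This
  lets a rule whose body is the truth symbol be applied without children; since truth symbol
  conjuncts are dropped from bodies, such a node takes the place of one whose only child is the
  truth symbol.
\<close>

datatype ('p, 'v, 'c) dproof =
    Leaf "('p, 'c) fact"
  | Step "('p, 'c) fact" "('p, 'v, 'c) drule" "('p, 'v, 'c) dproof list"

fun concl :: "('p, 'v, 'c) dproof \<Rightarrow> ('p, 'c) fact" where
  "concl (Leaf \<gamma>) = \<gamma>"
| "concl (Step \<gamma> r ts) = \<gamma>"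

fun dproof_rules :: "('p, 'v, 'c) dproof \<Rightarrow> ('p, 'v, 'c) drule set" where
  "dproof_rules (Leaf \<gamma>) = {}"
| "dproof_rules (Step \<gamma> r ts) = insert r (\<Union>t\<in>set ts. dproof_rules t)"

fun valid ::
    "('p, 'v, 'c) drule set \<Rightarrow> ('p, 'c) fact set \<Rightarrow> ('p, 'v, 'c) dproof \<Rightarrow> bool" where
  "valid P A (Leaf \<gamma>) \<longleftrightarrow> \<gamma> \<in> A"
| "valid P A (Step \<gamma> r ts) \<longleftrightarrow>
     r \<in> P \<and> consequence r (map concl ts) \<gamma> \<and> (\<forall>t\<in>set ts. valid P A t)"

definition fact_support ::
    "('p, 'v, 'c) drule set \<Rightarrow> ('p, 'c) fact set \<Rightarrow> ('p, 'c) fact \<Rightarrow> ('p, 'v, 'c) drule set" where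
  "fact_support P A \<gamma> = (\<Union>t\<in>{t. valid P A t \<and> concl t = \<gamma>}. dproof_rules t)"

section \<open>Module settings\<close>

record ('p, 'v, 'c) setting =
  theta :: "'v \<Rightarrow> 'c"
  abox0 :: "('p, 'c) fact set"
  aboxr :: "('p, 'c) fact set"

text \<open>Only the values of \<open>theta\<close> on the existentially quantified variables of the TBox matter.\<close>

definition module_setting ::
    "('p, 'v, 'c) rule set \<Rightarrow> 'p pred set \<Rightarrow> ('p, 'v, 'c) setting \<Rightarrow> bool" where
  "module_setting T \<Sigma> \<chi> \<longleftrightarrow>
     abox \<Sigma> (abox0 \<chi>) \<and>
     abox (sig T) (aboxr \<chi>) \<and>
     (theta \<chi> ` ex_vars T \<union> (\<Union>\<gamma>\<in>abox0 \<chi> \<union> aboxr \<chi>. set (args \<gamma>))) \<inter> tbox_consts T = {}"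

definition ex_subst :: "('v \<Rightarrow> 'c) \<Rightarrow> 'v list \<Rightarrow> 'v \<Rightarrow> ('v, 'c) trm" where
  "ex_subst \<theta> ys x = (if x \<in> set ys then Cst (\<theta> x) else Var x)"

definition datalog_rules ::
    "('p, 'v, 'c) setting \<Rightarrow> ('p, 'v, 'c) rule \<Rightarrow> ('p, 'v, 'c) drule set" where
  "datalog_rules \<chi> r =
     (if heads r = [] then {DRule (body r) (Atom Bot [])}
      else {DRule (body r) (atom_subst a (ex_subst (theta \<chi>) (exs r))) | a. a \<in> head_atoms r})"

definition program ::
    "('p, 'v, 'c) setting \<Rightarrow> ('p, 'v, 'c) rule set \<Rightarrow> ('p, 'v, 'c) drule set" where
  "program \<chi> T = (\<Union>r\<in>T. datalog_rules \<chi> r)"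

definition support ::
    "('p, 'v, 'c) setting \<Rightarrow> ('p, 'v, 'c) rule set \<Rightarrow> ('p, 'v, 'c) drule set" where
  "support \<chi> T = (\<Union>\<gamma>\<in>aboxr \<chi>. fact_support (program \<chi> T) (abox0 \<chi>) \<gamma>)"

definition module_of ::
    "('p, 'v, 'c) setting \<Rightarrow> ('p, 'v, 'c) rule set \<Rightarrow> ('p, 'v, 'c) rule set" where
  "module_of \<chi> T = {r \<in> T. datalog_rules \<chi> r \<inter> support \<chi> T \<noteq> {}}"

text \<open>
  The constants are \<open>cy y\<close> for existentially quantified variables \<open>y\<close>, \<open>cp A j\<close> with \<open>j < n\<close> for
  \<open>n\<close>-ary \<open>A\<close> in \<open>\<Sigma>\<close>, and \<open>st\<close> for the constant written as a star.
\<close>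

definition fresh_consts ::
    "('p, 'v, 'c) rule set \<Rightarrow> 'p pred set \<Rightarrow> ('v \<Rightarrow> 'c) \<Rightarrow> ('p pred \<Rightarrow> nat \<Rightarrow> 'c) \<Rightarrow> 'c \<Rightarrow> bool" where
  "fresh_consts T \<Sigma> cy cp st \<longleftrightarrow>
     (let Y = cy ` ex_vars T; S = (SIGMA A:\<Sigma>. {..<arity A}); P = (\<lambda>(A, j). cp A j) ` S in
      inj_on cy (ex_vars T) \<and> inj_on (\<lambda>(A, j). cp A j) S \<and>
      Y \<inter> P = {} \<and> st \<notin> Y \<union> P \<and>
      (Y \<union> P \<union> {st}) \<inter> tbox_consts T = {})"

definition pred_tuple :: "('p pred \<Rightarrow> nat \<Rightarrow> 'c) \<Rightarrow> 'p pred \<Rightarrow> 'c list" where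
  "pred_tuple cp A = map (cp A) [0..<arity A]"

definition star_facts :: "'p pred set \<Rightarrow> 'c \<Rightarrow> ('p, 'c) fact set" where
  "star_facts \<Sigma> st = {Atom A (replicate (arity A) st) | A. A \<in> \<Sigma>}"

definition pred_facts :: "'p pred set \<Rightarrow> ('p pred \<Rightarrow> nat \<Rightarrow> 'c) \<Rightarrow> ('p, 'c) fact set" where
  "pred_facts \<Sigma> cp = {Atom A (pred_tuple cp A) | A. A \<in> \<Sigma>}"

definition implication_facts ::
    "'p pred set \<Rightarrow> 'p pred set \<Rightarrow> ('p pred \<Rightarrow> nat \<Rightarrow> 'c) \<Rightarrow> ('p, 'c) fact set" where
  "implication_facts \<Sigma>\<^sub>A \<Sigma>\<^sub>B cp =
     {papp B (pred_tuple cp A) | A B. A \<in> \<Sigma>\<^sub>A \<and> B \<in> \<Sigma>\<^sub>B \<and> A \<noteq> B \<and> comparable A B}"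

fun chi ::
    "kind \<Rightarrow> ('v \<Rightarrow> 'c) \<Rightarrow> ('p pred \<Rightarrow> nat \<Rightarrow> 'c) \<Rightarrow> 'c \<Rightarrow>
     ('p, 'v, 'c) rule set \<Rightarrow> 'p pred set \<Rightarrow> ('p, 'v, 'c) setting" where
  "chi Kind_m cy cp st T \<Sigma> =
     \<lparr>theta = (\<lambda>_. st), abox0 = star_facts \<Sigma> st, aboxr = star_facts \<Sigma> st\<rparr>"
| "chi Kind_q cy cp st T \<Sigma> =
     \<lparr>theta = cy, abox0 = star_facts \<Sigma> st,
      aboxr = {\<gamma>. fact_over \<Sigma> \<gamma> \<and> set (args \<gamma>) \<subseteq> insert st (cy ` ex_vars T)}\<rparr>"
| "chi Kind_f cy cp st T \<Sigma> =
     \<lparr>theta = cy, abox0 = star_facts \<Sigma> st, aboxr = star_facts \<Sigma> st\<rparr>"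
| "chi Kind_i cy cp st T \<Sigma> =
     \<lparr>theta = cy, abox0 = pred_facts \<Sigma> cp, aboxr = implication_facts \<Sigma> \<Sigma> cp\<rparr>"
| "chi Kind_c cy cp st T \<Sigma> =
     \<lparr>theta = cy, abox0 = pred_facts \<Sigma> cp, aboxr = implication_facts \<Sigma> (sig T) cp\<rparr>"

lemma finite_sig: "finite T \<Longrightarrow> finite (sig T)"
  by (auto simp: sig_def rule_atoms_def head_atoms_def)

lemma module_setting_chi:
  assumes "tbox T" and "\<Sigma> \<subseteq> sig T" and "Bot \<in> \<Sigma>"
  shows "module_setting T \<Sigma> (chi z cy cp st T \<Sigma>)"
proof -
  have fS: "finite (sig T)" and fT: "finite T" and c0: "tbox_consts T = {}"
    using assms(1) finite_sig by (auto simp: tbox_def)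
  have f\<Sigma>: "finite \<Sigma>" using fS assms(2) finite_subset by blast
  have fY: "finite (insert st (cy ` ex_vars T))" using fT by (simp add: ex_vars_def)
  have star: "abox \<Sigma> (star_facts \<Sigma> st)"
    using f\<Sigma> by (auto simp: abox_def star_facts_def fact_over_def wf_atom_def)
  have pf: "abox \<Sigma> (pred_facts \<Sigma> cp)"
    using f\<Sigma> by (auto simp: abox_def pred_facts_def fact_over_def wf_atom_def pred_tuple_def)
  have im: "abox S (implication_facts \<Sigma> S cp)" if "finite S" for S
  proof -
    have "implication_facts \<Sigma> S cp \<subseteq> (\<lambda>(A, B). papp B (pred_tuple cp A)) ` (\<Sigma> \<times> S)"
      by (auto simp: implication_facts_def)
    then have "finite (implication_facts \<Sigma> S cp)"
      by (rule finite_subset) (use f\<Sigma> that in simp)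
    then show ?thesis
      by (auto simp: abox_def implication_facts_def fact_over_def wf_atom_def pred_tuple_def
          papp_def comparable_def)
  qed
  have q: "abox \<Sigma> {\<gamma>. fact_over \<Sigma> \<gamma> \<and> set (args \<gamma>) \<subseteq> insert st (cy ` ex_vars T)}" (is "abox \<Sigma> ?Q")
  proof -
    have "?Q \<subseteq> (\<Union>A\<in>\<Sigma>. Atom A ` {ds. set ds \<subseteq> insert st (cy ` ex_vars T) \<and> length ds = arity A})"
    proof
      fix \<gamma> assume "\<gamma> \<in> ?Q"
      then show "\<gamma> \<in> (\<Union>A\<in>\<Sigma>. Atom A `
          {ds. set ds \<subseteq> insert st (cy ` ex_vars T) \<and> length ds = arity A})"
        by (cases \<gamma>) (auto simp: fact_over_def wf_atom_def)
    qed
    then have "finite ?Q"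
      by (rule finite_subset) (use f\<Sigma> fY finite_lists_length_eq in blast)
    then show ?thesis by (auto simp: abox_def)
  qed
  have mono: "abox (sig T) A" if "abox \<Sigma> A" for A :: "('a, 'c) fact set"
    using that assms(2) by (auto simp: abox_def fact_over_def)
  show ?thesis
    using star pf im[OF f\<Sigma>] im[OF fS] q c0 mono
    by (cases z) (auto simp: module_setting_def)
qed

end

theory Submission
  imports Defs
begin

text \<open>
  Let \<open>M\<close> be the module of a setting. A model \<open>I\<close> of \<open>N \<subseteq> M\<close> is turned into a model of
  \<open>N \<union> (T - M)\<close> by pairing the elements of \<open>I\<close> with constants of the setting. A tuple of pairs
  is put into a predicate if the corresponding fact about the constants is derivable in the datalog
  program and, in case all its proofs stay inside the support, the tuple of elements is in the
  predicate in \<open>I\<close>. An instance of a rule whose body holds then either has only unsupported facts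
  in its head, which hold unconditionally, or it is part of a proof inside the support; then the
  rule is in \<open>M\<close>, its body holds in \<open>I\<close>, and a head can be copied from \<open>I\<close>. Facts of \<open>\<A>\<^sub>r\<close> are
  supported or not derivable, so nothing \<open>\<A>\<^sub>r\<close> represents is added. Taking \<open>N = M\<close> and
  \<open>N = {}\<close> gives the two halves of the theorem.
\<close>

section \<open>Datalog proofs\<close>

fun trm_inst :: "('v \<Rightarrow> 'c) \<Rightarrow> ('v, 'c) trm \<Rightarrow> 'c" where
  "trm_inst f (Var x) = f x"
| "trm_inst f (Cst c) = c"

text \<open>Total assignments of constants are used, so that an assignment \<open>v\<close> into the
  expanded structure gives the ground instance for \<open>\<pi> \<circ> v\<close> at once.\<close>

definition fact_inst :: "('v \<Rightarrow> 'c) \<Rightarrow> ('p, 'v, 'c) fatom \<Rightarrow> ('p, 'c) fact" where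
  "fact_inst f = map_atom (trm_inst f)"

lemma ground_fact_inst: "ground (fact_inst f a) = atom_subst a (\<lambda>x. Cst (f x))"
proof -
  have "Cst (trm_inst f t) = trm_subst t (\<lambda>x. Cst (f x))" for t
    by (cases t) auto
  then show ?thesis
    by (simp add: ground_def fact_inst_def atom_subst_def atom.map_comp comp_def)
qed

lemma trm_subst_cong: "(\<And>x. x \<in> trm_vars t \<Longrightarrow> \<sigma> x = \<tau> x) \<Longrightarrow> trm_subst t \<sigma> = trm_subst t \<tau>"
  by (cases t) auto

lemma atom_subst_cong:
  "(\<And>x. x \<in> atom_vars a \<Longrightarrow> \<sigma> x = \<tau> x) \<Longrightarrow> atom_subst a \<sigma> = atom_subst a \<tau>"
  by (cases a) (auto simp: atom_subst_def atom_vars_def intro!: trm_subst_cong)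

lemma atom_subst_eqD:
  assumes "atom_subst a \<sigma> = atom_subst a \<tau>" and "x \<in> atom_vars a"
  shows "\<sigma> x = \<tau> x"
proof -
  obtain t where t: "t \<in> set (args a)" "x \<in> trm_vars t"
    using assms(2) by (auto simp: atom_vars_def)
  have "t = Var x" using t(2) by (cases t) auto
  moreover have "trm_subst t \<sigma> = trm_subst t \<tau>"
    using assms(1) t(1) by (cases a) (auto simp: atom_subst_def)
  ultimately show ?thesis by simp
qed

lemma atom_subst_ground: "atom_subst (ground \<gamma>) \<sigma> = ground \<gamma>"
  by (simp add: atom_subst_def ground_def atom.map_comp comp_def)

text \<open>A unifier of a body with ground facts is forced on the body variables, so grounding
  exactly these is most general. By the assumption, which safety will supply, this grounds the head
  as well.\<close>

lemma consequence_fact_inst: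
  fixes bs :: "('p, 'v, 'c) fatom list"
  assumes "atom_vars \<delta> \<subseteq> (\<Union>b\<in>set bs. atom_vars b)"
  shows "consequence (DRule bs \<delta>) (map (fact_inst f) bs) (fact_inst f \<delta>)"
proof -
  define X where "X = (\<Union>b\<in>set bs. atom_vars b)"
  \<comment> \<open>Variables outside the body stay untouched; grounding them too would destroy
    generality.\<close>
  define \<sigma> where "\<sigma> x = (if x \<in> X then Cst (f x) else Var x)" for x
  define E :: "('p, 'v, 'c) eqs" where "E = set (zip (map ground (map (fact_inst f) bs)) bs)"
  have E: "E = (\<lambda>b. (ground (fact_inst f b), b)) ` set bs"
    unfolding E_def by (induction bs) auto
  have \<sigma>: "atom_subst a \<sigma> = ground (fact_inst f a)" if "atom_vars a \<subseteq> X" for a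
    unfolding ground_fact_inst by (rule atom_subst_cong) (use that in \<open>auto simp: \<sigma>_def\<close>)
  have sub: "atom_vars b \<subseteq> X" if "b \<in> set bs" for b
    using that by (auto simp: X_def)
  have "unifier E \<sigma>"
    using \<sigma>[OF sub] by (auto simp: unifier_def E atom_subst_ground)
  moreover have "\<exists>\<rho>. \<forall>x. \<tau> x = trm_subst (\<sigma> x) \<rho>" if \<tau>: "unifier E \<tau>" for \<tau>
  proof (intro exI allI)
    fix x
    \<comment> \<open>The factor is \<open>\<tau>\<close> itself: on \<open>X\<close> both sides are
      the same constant, elsewhere \<open>\<sigma>\<close> is the identity.\<close>
    show "\<tau> x = trm_subst (\<sigma> x) \<tau>"
    proof (cases "x \<in> X")
      case True
      then obtain b where b: "b \<in> set bs" "x \<in> atom_vars b" by (auto simp: X_def)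
      have "atom_subst b \<tau> = ground (fact_inst f b)"
        using \<tau> b(1) by (auto simp: unifier_def E atom_subst_ground)
      then show ?thesis
        using atom_subst_eqD[OF _ b(2)] True by (simp add: ground_fact_inst \<sigma>_def)
    qed (simp add: \<sigma>_def)
  qed
  ultimately have "mgu E \<sigma>" by (simp add: mgu_def)
  moreover have "ground (fact_inst f \<delta>) = atom_subst \<delta> \<sigma>"
    using \<sigma>[of \<delta>] assms by (simp add: X_def)
  ultimately show ?thesis by (auto simp: E_def)
qed

section \<open>Derivable facts and the support of a setting\<close>

definition derivable ::
    "('p, 'v, 'c) setting \<Rightarrow> ('p, 'v, 'c) rule set \<Rightarrow> ('p, 'c) fact \<Rightarrow> bool" where
  "derivable \<chi> T \<gamma> \<longleftrightarrow> (\<exists>t. valid (program \<chi> T) (abox0 \<chi>) t \<and> concl t = \<gamma>)"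

text \<open>This quantifies over all proofs of the fact, and so it holds vacuously for a fact
  without proofs.\<close>

definition supported ::
    "('p, 'v, 'c) setting \<Rightarrow> ('p, 'v, 'c) rule set \<Rightarrow> ('p, 'c) fact \<Rightarrow> bool" where
  "supported \<chi> T \<gamma> \<longleftrightarrow> fact_support (program \<chi> T) (abox0 \<chi>) \<gamma> \<subseteq> support \<chi> T"

lemma derivable_abox0: "\<gamma> \<in> abox0 \<chi> \<Longrightarrow> derivable \<chi> T \<gamma>"
  unfolding derivable_def by (rule exI[of _ "Leaf \<gamma>"]) simp

lemma supported_aboxr: "\<gamma> \<in> aboxr \<chi> \<Longrightarrow> supported \<chi> T \<gamma>"
  by (auto simp: supported_def support_def)

text \<open>Any prescribed proof of one premise extends to a proof of the conclusion, the other
  premises taking arbitrary proofs. This lets support pass from conclusions to premises.\<close>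

lemma valid_step_of_derivable:
  assumes "d \<in> program \<chi> T" and "consequence d \<gamma>s \<gamma>" and "\<forall>\<beta>\<in>set \<gamma>s. derivable \<chi> T \<beta>"
    and "\<beta> \<in> set \<gamma>s" and "valid (program \<chi> T) (abox0 \<chi>) t" and "concl t = \<beta>"
  shows "\<exists>ts. valid (program \<chi> T) (abox0 \<chi>) (Step \<gamma> d ts) \<and> t \<in> set ts"
proof -
  obtain F where F: "\<And>\<beta>. \<beta> \<in> set \<gamma>s \<Longrightarrow> valid (program \<chi> T) (abox0 \<chi>) (F \<beta>) \<and> concl (F \<beta>) = \<beta>"
    using assms(3) unfolding derivable_def by metis
  \<comment> \<open>Proofs are chosen per fact, so repeated occurrences of \<open>\<beta>\<close>
    all receive \<open>t\<close>.\<close>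
  define G where "G = F(\<beta> := t)"
  have G: "valid (program \<chi> T) (abox0 \<chi>) (G \<alpha>) \<and> concl (G \<alpha>) = \<alpha>" if "\<alpha> \<in> set \<gamma>s" for \<alpha>
    using F[OF that] assms(5,6) by (simp add: G_def)
  then have "map concl (map G \<gamma>s) = \<gamma>s"
    by (simp add: map_idI)
  then have "valid (program \<chi> T) (abox0 \<chi>) (Step \<gamma> d (map G \<gamma>s))"
    using assms(1,2) G by simp
  moreover have "t \<in> set (map G \<gamma>s)"
    using assms(4) by (force simp: G_def)
  ultimately show ?thesis by blast
qed

lemma derivable_step:
  assumes "d \<in> program \<chi> T" and "consequence d \<gamma>s \<gamma>" and "\<forall>\<beta>\<in>set \<gamma>s. derivable \<chi> T \<beta>"
  shows "\<exists>ts. valid (program \<chi> T) (abox0 \<chi>) (Step \<gamma> d ts)"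
\<comment> \<open>An empty body offers no premise with a prescribed proof; there the step has no
  children.\<close>
proof (cases \<gamma>s)
  case Nil
  then show ?thesis
    using assms by (intro exI[of _ "[]"]) simp
next
  case (Cons \<beta> \<beta>s)
  then show ?thesis
    using valid_step_of_derivable[OF assms] assms(3) unfolding derivable_def
    by (metis list.set_intros(1))
qed

text \<open>Every proof of a premise is a subtree of a proof of \<open>\<gamma>\<close> ending in
  \<open>d\<close>, and all rules of such a proof lie in the support.\<close>

lemma supported_step:
  assumes "d \<in> program \<chi> T" and "consequence d \<gamma>s \<gamma>" and "\<forall>\<beta>\<in>set \<gamma>s. derivable \<chi> T \<beta>"
    and "supported \<chi> T \<gamma>"
  shows "d \<in> support \<chi> T" and "\<forall>\<beta>\<in>set \<gamma>s. supported \<chi> T \<beta>"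
proof -
  have sup: "dproof_rules t \<subseteq> support \<chi> T"
    if "valid (program \<chi> T) (abox0 \<chi>) t" "concl t = \<gamma>" for t
    using assms(4) that unfolding supported_def fact_support_def by blast
  show "d \<in> support \<chi> T"
    using derivable_step[OF assms(1-3)] sup by fastforce
  show "\<forall>\<beta>\<in>set \<gamma>s. supported \<chi> T \<beta>"
  proof (unfold supported_def fact_support_def, safe)
    fix \<beta> t d'
    assume t: "concl t \<in> set \<gamma>s" "valid (program \<chi> T) (abox0 \<chi>) t" "d' \<in> dproof_rules t"
    obtain ts where "valid (program \<chi> T) (abox0 \<chi>) (Step \<gamma> d ts)" "t \<in> set ts"
      using valid_step_of_derivable[OF assms(1-3) t(1,2)] by blast
    then show "d' \<in> support \<chi> T"
      using sup[of "Step \<gamma> d ts"] t(3) by auto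
  qed
qed

section \<open>Instances of rules with existential variables replaced by constants\<close>

lemma fact_inst_ex_subst:
  "fact_inst f (atom_subst a (ex_subst \<theta> ys)) = fact_inst (\<lambda>x. if x \<in> set ys then \<theta> x else f x) a"
proof -
  have "trm_inst f (trm_subst t (ex_subst \<theta> ys)) = trm_inst (\<lambda>x. if x \<in> set ys then \<theta> x else f x) t"
    for t by (cases t) (auto simp: ex_subst_def)
  then show ?thesis
    by (simp add: fact_inst_def atom_subst_def atom.map_comp comp_def)
qed

lemma atom_vars_ex_subst: "atom_vars (atom_subst a (ex_subst \<theta> ys)) \<subseteq> atom_vars a - set ys"
proof -
  have "trm_vars (trm_subst t (ex_subst \<theta> ys)) \<subseteq> trm_vars t - set ys" for t
    by (cases t) (auto simp: ex_subst_def)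
  then show ?thesis
    by (cases a) (fastforce simp: atom_vars_def atom_subst_def)
qed

text \<open>One of the datalog rules of \<open>r\<close> derives \<open>\<gamma>\<close> from the
  instantiated body. If \<open>\<gamma>\<close> is supported, that datalog rule is in the support,
  which puts \<open>r\<close> into the module. Falsehood plays the part of the head atom when there
  are no disjuncts.\<close>

lemma rule_instance:
  assumes "r \<in> T" and "wf_rule r"
    and "\<forall>b\<in>set (body r). derivable \<chi> T (fact_inst f b)"
    and "heads r = [] \<and> \<gamma> = Atom Bot [] \<or>
      (\<exists>a\<in>head_atoms r. \<gamma> = fact_inst (\<lambda>x. if x \<in> set (exs r) then theta \<chi> x else f x) a)"
  shows "derivable \<chi> T \<gamma>"
    and "supported \<chi> T \<gamma> \<Longrightarrow>
      r \<in> module_of \<chi> T \<and> (\<forall>b\<in>set (body r). supported \<chi> T (fact_inst f b))"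
proof -
  obtain \<delta> where \<delta>: "DRule (body r) \<delta> \<in> datalog_rules \<chi> r" "\<gamma> = fact_inst f \<delta>"
    "atom_vars \<delta> \<subseteq> (\<Union>b\<in>set (body r). atom_vars b)"
    using assms(4)
  proof (elim disjE conjE bexE)
    assume "heads r = []" "\<gamma> = Atom Bot []"
    then show thesis
      by (intro that[of "Atom Bot []"])
        (auto simp: datalog_rules_def fact_inst_def atom_vars_def)
  next
    fix a assume a: "a \<in> head_atoms r"
      "\<gamma> = fact_inst (\<lambda>x. if x \<in> set (exs r) then theta \<chi> x else f x) a"
    \<comment> \<open>Safety: the head variables that survive the substitution occur in the
      body.\<close>
    have "atom_vars a - set (exs r) \<subseteq> (\<Union>b\<in>set (body r). atom_vars b)"
      using a(1) assms(2) unfolding wf_rule_def head_vars_def body_vars_def by blast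
    then show thesis
      using a atom_vars_ex_subst[of a "theta \<chi>" "exs r"]
      by (intro that[of "atom_subst a (ex_subst (theta \<chi>) (exs r))"])
        (auto simp: datalog_rules_def fact_inst_ex_subst head_atoms_def)
  qed
  have P: "DRule (body r) \<delta> \<in> program \<chi> T"
    using \<delta>(1) assms(1) by (auto simp: program_def)
  have C: "consequence (DRule (body r) \<delta>) (map (fact_inst f) (body r)) \<gamma>"
    using consequence_fact_inst[OF \<delta>(3)] \<delta>(2) by simp
  have D: "\<forall>\<beta>\<in>set (map (fact_inst f) (body r)). derivable \<chi> T \<beta>"
    using assms(3) by simp
  show "derivable \<chi> T \<gamma>"
    using derivable_step[OF P C D] concl.simps(2) unfolding derivable_def by blast
  show "r \<in> module_of \<chi> T \<and> (\<forall>b\<in>set (body r). supported \<chi> T (fact_inst f b))"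
    if "supported \<chi> T \<gamma>"
    using supported_step[OF P C D that] \<delta>(1) assms(1) by (auto simp: module_of_def)
qed

section \<open>Expanding a model of the module\<close>

text \<open>Elements of \<open>D\<close> stand for pairs, with projections \<open>p\<close> into \<open>I\<close> and \<open>\<pi>\<close> to constants.\<close>

definition expand ::
    "('p, 'v, 'c) setting \<Rightarrow> ('p, 'v, 'c) rule set \<Rightarrow> ('p, 'c, 'd) interp \<Rightarrow>
     'e set \<Rightarrow> ('e \<Rightarrow> 'd) \<Rightarrow> ('e \<Rightarrow> 'c) \<Rightarrow> ('c \<Rightarrow> 'e) \<Rightarrow> ('p, 'c, 'e) interp" where
  "expand \<chi> T I D p \<pi> k =
     \<lparr>dmn = D,
      pint = (\<lambda>P. {es. set es \<subseteq> D \<and> length es = arity P \<and> derivable \<chi> T (Atom P (map \<pi> es)) \<and>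
        (supported \<chi> T (Atom P (map \<pi> es)) \<longrightarrow> map p es \<in> pint I P)}),
      cint = k\<rparr>"

section \<open>Truth of atoms and rules in the expansion\<close>

lemma expand_simps [simp]:
  "dmn (expand \<chi> T I D p \<pi> k) = D"
  "cint (expand \<chi> T I D p \<pi> k) = k"
  "es \<in> pint (expand \<chi> T I D p \<pi> k) P \<longleftrightarrow>
     set es \<subseteq> D \<and> length es = arity P \<and> derivable \<chi> T (Atom P (map \<pi> es)) \<and>
     (supported \<chi> T (Atom P (map \<pi> es)) \<longrightarrow> map p es \<in> pint I P)"
  by (auto simp: expand_def)

text \<open>The point is that falsehood stays empty: as a fact of \<open>aboxr \<chi>\<close> it is
  supported, so it could hold only if it held in \<open>I\<close>.\<close>

lemma is_interp_expand:
  assumes "is_interp I" and "Atom Bot [] \<in> aboxr \<chi>" and "D \<noteq> {}" and "range k \<subseteq> D"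
  shows "is_interp (expand \<chi> T I D p \<pi> k)"
proof -
  have "pint I Bot = {}" using assms(1) by (simp add: is_interp_def)
  then show ?thesis
    using assms(3,4) supported_aboxr[OF assms(2)] by (auto simp: is_interp_def)
qed

text \<open>Without constants all arguments are variables, so both projections commute with
  evaluation.\<close>

lemma sat_atom_expand:
  assumes "range v \<subseteq> D" and "wf_atom a" and "atom_consts a = {}"
  shows "sat_atom (expand \<chi> T I D p \<pi> k) v a \<longleftrightarrow>
    derivable \<chi> T (fact_inst (\<pi> \<circ> v) a) \<and>
    (supported \<chi> T (fact_inst (\<pi> \<circ> v) a) \<longrightarrow> sat_atom I (p \<circ> v) a)"
proof -
  let ?J = "expand \<chi> T I D p \<pi> k"
  have var: "\<exists>x. t = Var x" if "t \<in> set (args a)" for t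
  proof -
    have "trm_consts t = {}" using that assms(3) by (simp add: atom_consts_def)
    then show ?thesis by (cases t) auto
  qed
  have \<pi>: "map \<pi> (map (trm_val ?J v) (args a)) = map (trm_inst (\<pi> \<circ> v)) (args a)"
    using var by fastforce
  have p: "map p (map (trm_val ?J v) (args a)) = map (trm_val I (p \<circ> v)) (args a)"
    using var by fastforce
  have D: "set (map (trm_val ?J v) (args a)) \<subseteq> D"
    using var assms(1) by fastforce
  have F: "Atom (psym a) (map (trm_inst (\<pi> \<circ> v)) (args a)) = fact_inst (\<pi> \<circ> v) a"
    by (cases a) (simp add: fact_inst_def)
  show ?thesis
    unfolding sat_atom_def expand_simps \<pi> p F using D assms(2) by (simp add: wf_atom_def)
qed

text \<open>The condition \<open>lift\<close> provides, for an existential variable, an element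
  above a prescribed witness in \<open>I\<close> whose constant is the one chosen by
  \<open>theta \<chi>\<close>.\<close>

lemma sat_rule_expand:
  fixes T :: "('p, 'v, 'c) rule set" and D :: "'e set"
  assumes "tbox T" and "r \<in> T" and "r \<in> module_of \<chi> T \<Longrightarrow> sat_rule I r"
    and "Atom Bot [] \<in> aboxr \<chi>" and "p ` D \<subseteq> dmn I"
    and lift: "\<And>d y. d \<in> dmn I \<Longrightarrow> y \<in> ex_vars T \<Longrightarrow> \<exists>e\<in>D. p e = d \<and> \<pi> e = theta \<chi> y"
  shows "sat_rule (expand \<chi> T I D p \<pi> k) r"
  unfolding sat_rule_def expand_simps
proof (intro allI impI)
  let ?J = "expand \<chi> T I D p \<pi> k"
  fix v :: "'v \<Rightarrow> 'e"
  assume v: "range v \<subseteq> D" and body: "\<forall>a\<in>set (body r). sat_atom ?J v a"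
  have wf: "wf_rule r" using assms(1,2) by (simp add: tbox_def)
  have atoms: "wf_atom a \<and> atom_consts a = {}" if "a \<in> rule_atoms r" for a
    using that wf assms(1,2) by (auto simp: wf_rule_def tbox_def tbox_consts_def)
  note sat_J = sat_atom_expand[where \<chi> = \<chi> and T = T and I = I and p = p and \<pi> = \<pi> and k = k]
  have bodyD: "derivable \<chi> T (fact_inst (\<pi> \<circ> v) b)"
      "supported \<chi> T (fact_inst (\<pi> \<circ> v) b) \<Longrightarrow> sat_atom I (p \<circ> v) b"
    if "b \<in> set (body r)" for b
    using that body atoms sat_J[OF v] by (auto simp: rule_atoms_def)
  have pv: "range (p \<circ> v) \<subseteq> dmn I" using v assms(5) by auto
  define F :: "('p, 'v, 'c) fatom \<Rightarrow> ('p, 'c) fact"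
    where "F = fact_inst (\<lambda>x. if x \<in> set (exs r) then theta \<chi> x else (\<pi> \<circ> v) x)"
  \<comment> \<open>If one head fact is supported, then \<open>r\<close> is in the module and its
    body is supported, hence true in \<open>I\<close> under \<open>p \<circ> v\<close>; so
    \<open>I\<close> supplies witnesses and a disjunct.\<close>
  have inst: "derivable \<chi> T \<gamma>" "supported \<chi> T \<gamma> \<Longrightarrow> \<exists>w. ex_variant I (exs r) (p \<circ> v) w \<and>
      (\<exists>\<psi>\<in>set (heads r). \<forall>a\<in>set \<psi>. sat_atom I w a)"
    if "heads r = [] \<and> \<gamma> = Atom Bot [] \<or> (\<exists>a\<in>head_atoms r. \<gamma> = F a)" for \<gamma>
    using rule_instance[OF assms(2) wf, of \<chi> "\<pi> \<circ> v" \<gamma>] that bodyD assms(3) pv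
    unfolding F_def sat_rule_def by blast+
  have "\<exists>w0. ex_variant I (exs r) (p \<circ> v) w0 \<and>
    (\<exists>\<psi>\<in>set (heads r). \<forall>a\<in>set \<psi>. supported \<chi> T (F a) \<longrightarrow> sat_atom I w0 a)"
  proof (cases "\<exists>\<gamma>. (heads r = [] \<and> \<gamma> = Atom Bot [] \<or> (\<exists>a\<in>head_atoms r. \<gamma> = F a)) \<and>
      supported \<chi> T \<gamma>")
    case True
    then obtain \<gamma> where
      "heads r = [] \<and> \<gamma> = Atom Bot [] \<or> (\<exists>a\<in>head_atoms r. \<gamma> = F a)" "supported \<chi> T \<gamma>"
      by (elim exE conjE)
    from inst(2)[OF this] show ?thesis by metis
  next
    case False
    then have F: "\<not> supported \<chi> T (F a)" if "a \<in> head_atoms r" for a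
      using that by metis
    \<comment> \<open>An empty head would produce falsehood, which is supported. Hence a disjunct
      exists, and any of them will do since none of its atoms is supported.\<close>
    have "heads r \<noteq> []" using False supported_aboxr[OF assms(4)] by metis
    then have "hd (heads r) \<in> set (heads r)" by simp
    moreover from this have "\<forall>a\<in>set (hd (heads r)). \<not> supported \<chi> T (F a)"
      using F by (auto simp: head_atoms_def)
    moreover have "ex_variant I (exs r) (p \<circ> v) (p \<circ> v)"
      using pv by (simp add: ex_variant_def)
    ultimately show ?thesis by metis
  qed
  then obtain w0 \<psi> where w0: "range w0 \<subseteq> dmn I" "\<And>x. x \<notin> set (exs r) \<Longrightarrow> w0 x = p (v x)"
    and \<psi>: "\<psi> \<in> set (heads r)" "\<And>a. a \<in> set \<psi> \<Longrightarrow> supported \<chi> T (F a) \<Longrightarrow> sat_atom I w0 a"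
    by (auto simp: ex_variant_def)
  \<comment> \<open>The witnesses \<open>w0\<close> are lifted to \<open>D\<close>: existential
    variables receive their constant from \<open>theta \<chi>\<close>, all others keep the value
    under \<open>v\<close>.\<close>
  have "\<forall>x. \<exists>e\<in>D. p e = w0 x \<and>
      (if x \<in> set (exs r) then \<pi> e = theta \<chi> x else e = v x)"
  proof
    fix x
    show "\<exists>e\<in>D. p e = w0 x \<and> (if x \<in> set (exs r) then \<pi> e = theta \<chi> x else e = v x)"
    proof (cases "x \<in> set (exs r)")
      case True
      then have "x \<in> ex_vars T" using assms(2) by (auto simp: ex_vars_def)
      moreover have "w0 x \<in> dmn I" using w0(1) by blast
      ultimately show ?thesis using lift True by simp
    next
      case False
      then show ?thesis using w0(2) v by auto
    qed
  qed
  then obtain w where w: "\<And>x. w x \<in> D" "\<And>x. p (w x) = w0 x"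
    "\<And>x. if x \<in> set (exs r) then \<pi> (w x) = theta \<chi> x else w x = v x"
    by metis
  have pw: "p \<circ> w = w0" using w(2) by auto
  \<comment> \<open>Hence the head instances under \<open>w\<close> are exactly the facts derived by
    the datalog rules.\<close>
  have "\<pi> \<circ> w = (\<lambda>x. if x \<in> set (exs r) then theta \<chi> x else (\<pi> \<circ> v) x)"
    using w(3) by (fastforce split: if_splits)
  then have \<pi>w: "fact_inst (\<pi> \<circ> w) a = F a" for a by (simp only: F_def)
  have rw: "range w \<subseteq> D" using w(1) by blast
  have "sat_atom ?J w a" if "a \<in> set \<psi>" for a
  proof -
    have a: "a \<in> head_atoms r" using that \<psi>(1) by (auto simp: head_atoms_def)
    then have "wf_atom a" "atom_consts a = {}"
      using atoms by (simp_all add: rule_atoms_def)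
    moreover have "derivable \<chi> T (F a)" using inst(1) a by blast
    ultimately show ?thesis
      using sat_J[OF rw] \<psi>(2)[OF that] pw \<pi>w by simp
  qed
  moreover have "ex_variant ?J (exs r) v w"
    using rw w(3) by (auto simp: ex_variant_def split: if_splits)
  ultimately show "\<exists>w. ex_variant ?J (exs r) v w \<and> (\<exists>\<psi>\<in>set (heads r). \<forall>a\<in>set \<psi>. sat_atom ?J w a)"
    using \<psi>(1) by blast
qed

lemma model_expand:
  assumes "tbox T" and "N \<subseteq> module_of \<chi> T" and "model I (RuleS ` N)"
    and "Atom Bot [] \<in> aboxr \<chi>" and "D \<noteq> {}" and "range k \<subseteq> D" and "p ` D \<subseteq> dmn I"
    and "\<And>d y. d \<in> dmn I \<Longrightarrow> y \<in> ex_vars T \<Longrightarrow> \<exists>e\<in>D. p e = d \<and> \<pi> e = theta \<chi> y"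
  shows "model (expand \<chi> T I D p \<pi> k) (RuleS ` (N \<union> (T - module_of \<chi> T)))"
proof -
  have "sat_rule (expand \<chi> T I D p \<pi> k) r" if "r \<in> N \<union> (T - module_of \<chi> T)" for r
  proof (rule sat_rule_expand[OF assms(1) _ _ assms(4,7,8)])
    show "r \<in> T" using that assms(2) by (auto simp: module_of_def)
    \<comment> \<open>A rule of the module can only come from \<open>N\<close>, whose rules hold in
      \<open>I\<close>.\<close>
    show "sat_rule I r" if "r \<in> module_of \<chi> T"
      using \<open>r \<in> N \<union> _\<close> that assms(3) by (auto simp: model_def)
  qed
  moreover have "is_interp I" using assms(3) by (simp add: model_def)
  ultimately show ?thesis
    using is_interp_expand[OF _ assms(4-6)] by (auto simp: model_def)
qed

text \<open>Entailment ranges over domains inside the fixed type \<open>'d\<close>, so pairs must be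
  coded in \<open>'d\<close>. An infinite set absorbs a finite nonempty factor; an injection codes
  pairs and its inverse gives the projections.\<close>

lemma pairing_exists:
  includes cardinal_syntax
  assumes "infinite (UNIV :: 'd set)" and "finite C" and "C \<noteq> {}"
  shows "\<exists>(e :: 'd \<Rightarrow> 'c \<Rightarrow> 'd) p \<pi>. \<forall>d. \<forall>c\<in>C. p (e d c) = d \<and> \<pi> (e d c) = c"
proof -
  have "|C| \<le>o |UNIV :: 'd set|"
    using assms(1,2)
    by (intro ordLess_imp_ordLeq Cfinite_ordLess_Cinfinite)
      (simp_all add: cfinite_def cinfinite_def Field_card_of card_of_card_order_on)
  then have "|(UNIV :: 'd set) \<times> C| \<le>o |UNIV :: 'd set|"
    using card_of_Times_infinite[OF assms(1,3)] ordIso_imp_ordLeq by blast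
  then obtain g :: "'d \<times> 'c \<Rightarrow> 'd" where g: "inj_on g (UNIV \<times> C)"
    unfolding card_of_ordLeq[symmetric] by blast
  let ?h = "inv_into (UNIV \<times> C) g"
  have "?h (g (d, c)) = (d, c)" if "c \<in> C" for d c
    using g that by (simp add: inv_into_f_f)
  then show ?thesis
    by (intro exI[of _ "\<lambda>d c. g (d, c)"] exI[of _ "fst \<circ> ?h"] exI[of _ "snd \<circ> ?h"]) simp
qed

text \<open>The domain consists of all coded pairs over \<open>dmn I\<close> and \<open>C\<close>.
  Every constant of the language denotes its old value paired with \<open>st\<close>.\<close>

lemma model_expand_pairs:
  fixes I :: "('p, 'c, 'd) interp"
  assumes "infinite (UNIV :: 'd set)" and "tbox T" and "N \<subseteq> module_of \<chi> T"
    and "model I (RuleS ` N)" and "Atom Bot [] \<in> aboxr \<chi>"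
    and "finite C" and "st \<in> C" and "theta \<chi> ` ex_vars T \<subseteq> C"
  obtains e p \<pi> D k where
    "model (expand \<chi> T I D p \<pi> k :: ('p, 'c, 'd) interp) (RuleS ` (N \<union> (T - module_of \<chi> T)))"
    and "\<And>d c. d \<in> dmn I \<Longrightarrow> c \<in> C \<Longrightarrow> e d c \<in> D \<and> p (e d c) = d \<and> \<pi> (e d c) = c"
    and "p ` D \<subseteq> dmn I" and "\<pi> ` D \<subseteq> C"
    and "\<And>c. k c \<in> D \<and> p (k c) = cint I c \<and> \<pi> (k c) = st"
proof -
  obtain e :: "'d \<Rightarrow> 'c \<Rightarrow> 'd" and p \<pi>
    where e: "\<And>d c. c \<in> C \<Longrightarrow> p (e d c) = d \<and> \<pi> (e d c) = c"
    using pairing_exists[OF assms(1,6)] assms(7) by blast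
  define D where "D = (\<lambda>(d, c). e d c) ` (dmn I \<times> C)"
  define k where "k c = e (cint I c) st" for c
  have I: "is_interp I" using assms(4) by (simp add: model_def)
  then have "range (cint I) \<subseteq> dmn I" by (simp add: is_interp_def)
  then have c: "cint I c \<in> dmn I" for c by blast
  have D: "e d c \<in> D" if "d \<in> dmn I" "c \<in> C" for d c
    using that by (auto simp: D_def)
  have k: "k c \<in> D \<and> p (k c) = cint I c \<and> \<pi> (k c) = st" for c
    using D[OF c assms(7)] e[OF assms(7)] by (simp add: k_def)
  have pD: "p ` D \<subseteq> dmn I" "\<pi> ` D \<subseteq> C" using e by (auto simp: D_def)
  have "model (expand \<chi> T I D p \<pi> k) (RuleS ` (N \<union> (T - module_of \<chi> T)))"
  proof (rule model_expand[OF assms(2-5) _ _ pD(1)])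
    show "D \<noteq> {}" "range k \<subseteq> D" using k by blast+
    show "\<exists>x\<in>D. p x = d \<and> \<pi> x = theta \<chi> y" if "d \<in> dmn I" "y \<in> ex_vars T" for d y
      using that assms(8) D e by blast
  qed
  then show thesis using that[of D p \<pi> k e] D e pD k by blast
qed

text \<open>As all constants are paired with \<open>st\<close>, any fact is read in the datalog
  program as the star fact of its predicate.\<close>

lemma sat_fact_expand_star:
  assumes "Atom (psym \<gamma>) (replicate (arity (psym \<gamma>)) st) \<in> abox0 \<chi>" and "wf_atom \<gamma>"
    and k: "\<And>c. k c \<in> D \<and> p (k c) = cint I c \<and> \<pi> (k c) = st"
  shows "sat_fact (expand \<chi> T I D p \<pi> k) \<gamma> \<longleftrightarrow>
    (supported \<chi> T (Atom (psym \<gamma>) (replicate (arity (psym \<gamma>)) st)) \<longrightarrow> sat_fact I \<gamma>)"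
proof -
  have \<pi>: "map \<pi> (map k (args \<gamma>)) = replicate (arity (psym \<gamma>)) st"
    using k assms(2) by (simp add: wf_atom_def comp_def map_replicate_const)
  have p: "map p (map k (args \<gamma>)) = map (cint I) (args \<gamma>)"
    using k by simp
  have "set (map k (args \<gamma>)) \<subseteq> D" using k by auto
  then show ?thesis
    unfolding sat_fact_def expand_simps \<pi> p
    using derivable_abox0[OF assms(1)] assms(2) by (simp add: wf_atom_def)
qed

text \<open>Every fact over \<open>\<Sigma>\<close> with arguments in \<open>C\<close> is in
  \<open>aboxr \<chi>\<close>, hence supported, so true atoms project to true atoms of
  \<open>I\<close>. Conjunction and disjunction preserve this.\<close>

lemma sat_pos_project:
  assumes "range v \<subseteq> D" and "\<pi> ` D \<subseteq> C"
    and "\<And>c. k c \<in> D \<and> p (k c) = cint I c \<and> \<pi> (k c) = st"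
    and "\<forall>a\<in>pos_atoms \<phi>. wf_atom a \<and> psym a \<in> \<Sigma>"
    and "{\<gamma>. fact_over \<Sigma> \<gamma> \<and> set (args \<gamma>) \<subseteq> C} \<subseteq> aboxr \<chi>"
    and "sat_pos (expand \<chi> T I D p \<pi> k) v \<phi>"
  shows "sat_pos I (p \<circ> v) \<phi>"
  using assms(4,6)
proof (induction \<phi>)
  case (PAtom a)
  let ?J = "expand \<chi> T I D p \<pi> k"
  let ?es = "map (trm_val ?J v) (args a)"
  have pval: "p (trm_val ?J v t) = trm_val I (p \<circ> v) t" for t
    using assms(3) by (cases t) auto
  have "trm_val ?J v t \<in> D" for t
    using assms(1,3) by (cases t) auto
  then have "set (map \<pi> ?es) \<subseteq> C" using assms(2) by auto
  then have "Atom (psym a) (map \<pi> ?es) \<in> aboxr \<chi>"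
    by (intro subsetD[OF assms(5)])
      (use PAtom.prems(1) in \<open>simp add: fact_over_def wf_atom_def\<close>)
  from supported_aboxr[OF this, of T] have "map p ?es \<in> pint I (psym a)"
    using PAtom.prems(2) by (simp add: sat_atom_def)
  then show ?case using pval by (simp add: sat_atom_def comp_def)
qed auto

section \<open>The five inseparability relations\<close>

lemma entails_mono: "entails D F s \<Longrightarrow> F \<subseteq> F' \<Longrightarrow> entails D F' s"
  unfolding entails_def model_def by blast

text \<open>Countermodels of the smaller rule set are turned into countermodels of the larger one;
  the converse is monotonicity. Implications use it with an empty ABox.\<close>

lemma entails_iff_of_expansion:
  assumes "N \<subseteq> N'"
    and "\<And>I :: ('p, 'c, 'd) interp. model I (RuleS ` N) \<Longrightarrow> \<forall>\<gamma>\<in>A. sat_fact I \<gamma> \<Longrightarrow> \<not> sat I s \<Longrightarrow>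
      \<exists>J :: ('p, 'c, 'd) interp. model J (RuleS ` N') \<and> (\<forall>\<gamma>\<in>A. sat_fact J \<gamma>) \<and> \<not> sat J s"
  shows "entails TYPE('d) (RuleS ` N' \<union> FactS ` A) s \<longleftrightarrow>
    entails TYPE('d) (RuleS ` N \<union> FactS ` (A :: ('p, 'c) fact set)) s"
proof
  assume *: "entails TYPE('d) (RuleS ` N' \<union> FactS ` A) s"
  show "entails TYPE('d) (RuleS ` N \<union> FactS ` A) s"
    unfolding entails_def
  proof (intro allI impI, rule ccontr)
    fix I :: "('p, 'c, 'd) interp"
    assume I: "model I (RuleS ` N \<union> FactS ` A)" and s: "\<not> sat I s"
    have "model I (RuleS ` N)" "\<forall>\<gamma>\<in>A. sat_fact I \<gamma>"
      using I by (auto simp: model_def ball_Un)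
    from assms(2)[OF this s] obtain J :: "('p, 'c, 'd) interp"
      where "model J (RuleS ` N')" "\<forall>\<gamma>\<in>A. sat_fact J \<gamma>" "\<not> sat J s"
      by blast
    then show False using * by (auto simp: entails_def model_def ball_Un)
  qed
next
  assume "entails TYPE('d) (RuleS ` N \<union> FactS ` A) s"
  then show "entails TYPE('d) (RuleS ` N' \<union> FactS ` A) s"
    by (rule entails_mono) (use assms(1) in blast)
qed

section \<open>Implications between predicates\<close>

lemma ex_variant_Nil: "ex_variant I [] v w \<longleftrightarrow> range w \<subseteq> dmn I \<and> w = v"
  by (auto simp: ex_variant_def fun_eq_iff)

text \<open>Pairing the components of a counterexample tuple with the constants of
  \<open>pred_tuple cp A\<close> makes \<open>A\<close> derivable and \<open>B\<close> supported on
  the new tuple, so it refutes the implication again. Leaving \<open>\<Sigma>\<^sub>B\<close> open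
  covers both implication relations.\<close>

lemma entails_implication_iff:
  fixes N :: "('p, 'v, 'c) rule set"
  assumes "infinite (UNIV :: 'd set)" and "tbox T"
    and \<chi>: "theta \<chi> = cy" "abox0 \<chi> = pred_facts \<Sigma> cp" "aboxr \<chi> = implication_facts \<Sigma> \<Sigma>\<^sub>B cp"
    and "Bot \<in> \<Sigma>\<^sub>B" and "N \<subseteq> module_of \<chi> T"
    and AB: "A \<in> \<Sigma>" "B \<in> \<Sigma>\<^sub>B" "comparable A B" and xs: "distinct xs" "length xs = arity A"
  shows "entails TYPE('d) (RuleS ` (N \<union> (T - module_of \<chi> T))) (RuleS (implication A B xs)) \<longleftrightarrow>
    entails TYPE('d) (RuleS ` N) (RuleS (implication A B xs))"
proof -
  have "\<exists>J :: ('p, 'c, 'd) interp. model J (RuleS ` (N \<union> (T - module_of \<chi> T))) \<and>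
      \<not> sat_rule J (implication A B xs :: ('p, 'v, 'c) rule)"
    if I: "model I (RuleS ` N)" and nsat: "\<not> sat_rule I (implication A B xs :: ('p, 'v, 'c) rule)"
    for I :: "('p, 'c, 'd) interp"
  proof -
    have sat_papp: "sat_atom J v (papp P (map Var xs) :: ('p, 'v, 'c) fatom) \<longleftrightarrow>
        (if P = Bot then [] else map v xs) \<in> pint J P" for J :: "('p, 'c, 'd) interp" and v P
      by (simp add: sat_atom_def papp_def comp_def)
    have sat_imp: "sat_rule J (implication A B xs :: ('p, 'v, 'c) rule) \<longleftrightarrow>
      (\<forall>v. range v \<subseteq> dmn J \<longrightarrow> (if A = Bot then [] else map v xs) \<in> pint J A \<longrightarrow>
        (if B = Bot then [] else map v xs) \<in> pint J B)" for J :: "('p, 'c, 'd) interp"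
      by (auto simp: sat_rule_def implication_def sat_papp ex_variant_Nil)
    have bot: "pint I Bot = {}" using I by (simp add: model_def is_interp_def)
    obtain v where v: "range v \<subseteq> dmn I" "(if A = Bot then [] else map v xs) \<in> pint I A"
      "(if B = Bot then [] else map v xs) \<notin> pint I B"
      using nsat sat_imp by blast
    \<comment> \<open>A counterexample makes \<open>A\<close> true and \<open>B\<close> false, so
      \<open>A\<close> is neither falsehood nor \<open>B\<close>; thus both facts below belong to
      \<open>aboxr \<chi>\<close>.\<close>
    have A: "A \<noteq> Bot" and "A \<noteq> B" using v bot by (auto split: if_splits)
    have "papp B (pred_tuple cp A) \<in> aboxr \<chi>" "papp Bot (pred_tuple cp A) \<in> aboxr \<chi>"
      using AB A \<open>A \<noteq> B\<close> \<open>Bot \<in> \<Sigma>\<^sub>B\<close> by (auto simp: \<chi> implication_facts_def comparable_def)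
    then have B: "supported \<chi> T (papp B (pred_tuple cp A))" and r: "Atom Bot [] \<in> aboxr \<chi>"
      using supported_aboxr by (auto simp: papp_def)
    have 0: "derivable \<chi> T (Atom A (pred_tuple cp A))"
      using AB(1) by (intro derivable_abox0) (auto simp: \<chi> pred_facts_def)
    \<comment> \<open>Here \<open>undefined\<close> takes the place of the star and is also paired
      with the values of variables outside \<open>xs\<close>.\<close>
    define C where "C = insert undefined (cy ` ex_vars T \<union> set (pred_tuple cp A))"
    have C: "finite C" "undefined \<in> C" "theta \<chi> ` ex_vars T \<subseteq> C"
      using assms(2) by (auto simp: C_def ex_vars_def tbox_def \<chi>)
    obtain e p \<pi> D k where
      J: "model (expand \<chi> T I D p \<pi> k :: ('p, 'c, 'd) interp) (RuleS ` (N \<union> (T - module_of \<chi> T)))"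
      and e: "\<And>d c. d \<in> dmn I \<Longrightarrow> c \<in> C \<Longrightarrow> e d c \<in> D \<and> p (e d c) = d \<and> \<pi> (e d c) = c"
      by (rule model_expand_pairs[OF assms(1,2,7) I r C]) blast
    let ?J = "expand \<chi> T I D p \<pi> k"
    \<comment> \<open>The position of a variable in \<open>xs\<close>, well defined because
      \<open>xs\<close> is distinct.\<close>
    obtain i where i: "\<And>j. j < arity A \<Longrightarrow> i (xs ! j) = j"
      using xs inv_into_f_f[OF inj_on_nth[OF xs(1), of "{..<arity A}"]]
      by (metis lessThan_iff)
    define c where "c x = (if x \<in> set xs then cp A (i x) else undefined)" for x
    have c: "map c xs = pred_tuple cp A"
      using xs(2) i by (intro nth_equalityI) (auto simp: c_def pred_tuple_def)
    then have "set (pred_tuple cp A) = c ` set xs" by (metis set_map)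
    then have cC: "c x \<in> C" for x
      by (cases "x \<in> set xs") (auto simp: C_def c_def)
    define w where "w x = e (v x) (c x)" for x
    have w: "w x \<in> D" "p (w x) = v x" "\<pi> (w x) = c x" for x
    proof -
      have "v x \<in> dmn I" using v(1) by blast
      from e[OF this cC] show "w x \<in> D" "p (w x) = v x" "\<pi> (w x) = c x" by (simp_all add: w_def)
    qed
    have maps: "map p (map w xs) = map v xs" "map \<pi> (map w xs) = pred_tuple cp A"
      using w c by (auto simp: comp_def)
    have wD: "set (map w xs) \<subseteq> D" using w by auto
    have wA: "map w xs \<in> pint ?J A"
      unfolding expand_simps maps using wD 0 v(2) A xs(2) by simp
    have wB: "(if B = Bot then [] else map w xs) \<notin> pint ?J B"
    proof (cases "B = Bot")
      case True
      then show ?thesis using B bot by (simp add: papp_def)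
    next
      case False
      then have "supported \<chi> T (Atom B (map \<pi> (map w xs)))"
        using B unfolding maps by (simp add: papp_def)
      moreover have "map p (map w xs) \<notin> pint I B" using v(3) False unfolding maps by simp
      ultimately show ?thesis using False unfolding expand_simps by simp
    qed
    have "range w \<subseteq> dmn ?J" using w by auto
    then have "\<not> sat_rule ?J (implication A B xs :: ('p, 'v, 'c) rule)"
      unfolding sat_imp not_all not_imp using A wA wB by (intro exI[of _ w]) metis
    then show ?thesis using J by blast
  qed
  then show ?thesis
    using entails_iff_of_expansion[where A = "{}" and N = N and N' = "N \<union> (T - module_of \<chi> T)"
        and s = "RuleS (implication A B xs)" and 'd = 'd]
    by simp
qed

text \<open>Except for model inseparability, each relation is reduced to lifting countermodels to
  pairs.\<close>

lemma insep_module_part: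
  fixes T :: "('p, 'v, 'c) rule set"
  assumes inf: "infinite (UNIV :: 'd set)" and T: "tbox T"
    and \<Sigma>: "\<Sigma> \<subseteq> sig T" "Bot \<in> \<Sigma>"
    and \<chi>: "\<chi> = chi z cy cp st T \<Sigma>" and N: "N \<subseteq> module_of \<chi> T"
  shows "insep TYPE('d) z \<Sigma> (N \<union> (T - module_of \<chi> T)) N"
proof -
  let ?N' = "N \<union> (T - module_of \<chi> T)"
  define C where "C = insert st (cy ` ex_vars T)"
  have C: "finite C" "st \<in> C" "cy ` ex_vars T \<subseteq> C"
    using T by (auto simp: C_def ex_vars_def tbox_def)
  have star: "Atom P (replicate (arity P) st) \<in> star_facts \<Sigma> st" if "P \<in> \<Sigma>" for P
    using that by (auto simp: star_facts_def)
  have bot: "Atom Bot [] \<in> star_facts \<Sigma> st" using star[OF \<Sigma>(2)] by simp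
  show ?thesis
  proof (cases z)
    case Kind_m
    have \<chi>m: "theta \<chi> = (\<lambda>_. st)" "abox0 \<chi> = star_facts \<Sigma> st" "aboxr \<chi> = star_facts \<Sigma> st"
      by (simp_all add: \<chi> Kind_m)
    have "\<exists>J :: ('p, 'c, 'd) interp. model J (RuleS ` ?N') \<and> dmn J = dmn I \<and>
        (\<forall>A\<in>\<Sigma>. pint I A = pint J A)" if I: "model I (RuleS ` N)" for I :: "('p, 'c, 'd) interp"
    proof -
      have int: "is_interp I" using I by (simp add: model_def)
      \<comment> \<open>The domain must be kept. With \<open>st\<close> as the only constant each
        element is its own pair, so \<open>p\<close> is the identity and \<open>\<pi>\<close> is
        constant.\<close>
      let ?J = "expand \<chi> T I (dmn I) (\<lambda>d. d) (\<lambda>_. st) (cint I)"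
      have "model ?J (RuleS ` ?N')"
        using int bot by (intro model_expand[OF T N I]) (auto simp: \<chi>m is_interp_def)
      \<comment> \<open>Star facts are both derivable and supported, so membership in the expansion
        reduces to membership in \<open>I\<close>.\<close>
      moreover have "pint I A = pint ?J A" if "A \<in> \<Sigma>" for A
      proof -
        have "derivable \<chi> T (Atom A (replicate (arity A) st))"
          "supported \<chi> T (Atom A (replicate (arity A) st))"
          using star[OF that] by (auto intro: derivable_abox0 supported_aboxr simp: \<chi>m)
        moreover have "set es \<subseteq> dmn I" "length es = arity A" if "es \<in> pint I A" for es
          using int that by (auto simp: is_interp_def)
        ultimately show ?thesis
          by (intro set_eqI) (auto simp: map_replicate_const)
      qed
      ultimately show ?thesis by (intro exI[of _ ?J]) simp
    qed
    moreover have "models_extend TYPE('d) \<Sigma> ?N' N"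
      unfolding models_extend_def by (auto simp: model_def)
    ultimately show ?thesis by (simp add: Kind_m models_extend_def)
  next
    case Kind_q
    have \<chi>q: "theta \<chi> = cy" "abox0 \<chi> = star_facts \<Sigma> st"
      "aboxr \<chi> = {\<gamma>. fact_over \<Sigma> \<gamma> \<and> set (args \<gamma>) \<subseteq> C}"
      by (simp_all add: \<chi> Kind_q C_def)
    have r: "Atom Bot [] \<in> aboxr \<chi>"
      using \<Sigma>(2) by (simp add: \<chi>q fact_over_def wf_atom_def)
    have "entails TYPE('d) (RuleS ` ?N' \<union> FactS ` A) (QueryS Q) \<longleftrightarrow>
        entails TYPE('d) (RuleS ` N \<union> FactS ` A) (QueryS Q)"
      if Q: "query_over \<Sigma> Q" and A: "abox \<Sigma> A" for Q :: "('p, 'v, 'c) query" and A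
    proof (rule entails_iff_of_expansion)
      fix I :: "('p, 'c, 'd) interp"
      assume I: "model I (RuleS ` N)" and satA: "\<forall>\<gamma>\<in>A. sat_fact I \<gamma>"
        and nQ: "\<not> sat I (QueryS Q :: ('p, 'v, 'c) sentence)"
      obtain e p \<pi> D k where
        J: "model (expand \<chi> T I D p \<pi> k :: ('p, 'c, 'd) interp) (RuleS ` ?N')"
        and e: "\<And>d c. d \<in> dmn I \<Longrightarrow> c \<in> C \<Longrightarrow> e d c \<in> D \<and> p (e d c) = d \<and> \<pi> (e d c) = c"
        and D: "p ` D \<subseteq> dmn I" "\<pi> ` D \<subseteq> C"
        and k: "\<And>c. k c \<in> D \<and> p (k c) = cint I c \<and> \<pi> (k c) = st"
        by (rule model_expand_pairs[OF inf T N I r C(1,2)]) (use C(3) \<chi>q(1) in simp, blast)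
      let ?J = "expand \<chi> T I D p \<pi> k"
      have "sat_fact ?J \<gamma>" if "\<gamma> \<in> A" for \<gamma>
      proof -
        have "Atom (psym \<gamma>) (replicate (arity (psym \<gamma>)) st) \<in> abox0 \<chi>" "wf_atom \<gamma>"
          using that A star by (auto simp: abox_def fact_over_def \<chi>q)
        from sat_fact_expand_star[OF this k] show ?thesis using that satA by blast
      qed
      moreover have "\<not> sat_query ?J Q"
      proof
        assume QJ: "sat_query ?J Q"
        have "\<exists>w. ex_variant I (qvars Q) v w \<and> sat_pos I w (qpos Q)" if v: "range v \<subseteq> dmn I" for v
        proof -
          \<comment> \<open>A refuting assignment is lifted by pairing with \<open>st\<close>; a
            match of the query in the expansion then projects to a match in
            \<open>I\<close>.\<close>
          let ?v = "\<lambda>x. e (v x) st"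
          have ev: "?v x \<in> D \<and> p (?v x) = v x" for x
            using e[OF _ C(2)] v by blast
          then have "range ?v \<subseteq> dmn ?J" by auto
          then obtain w where w: "range w \<subseteq> D" "\<And>x. x \<notin> set (qvars Q) \<Longrightarrow> w x = ?v x"
            "sat_pos ?J w (qpos Q)"
            using QJ unfolding sat_query_def ex_variant_def by (metis expand_simps(1))
          have "sat_pos I (p \<circ> w) (qpos Q)"
            by (rule sat_pos_project[where \<Sigma> = \<Sigma>, OF w(1) D(2) k _ _ w(3)])
              (use Q in \<open>auto simp: query_over_def \<chi>q\<close>)
          moreover have "ex_variant I (qvars Q) v (p \<circ> w)"
          proof -
            have "p (w x) \<in> dmn I" for x
              using subsetD[OF D(1) imageI, of "w x"] w(1) by auto
            then show ?thesis using w(2) ev by (auto simp: ex_variant_def)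
          qed
          ultimately show ?thesis by blast
        qed
        then show False using nQ by (simp add: sat_query_def)
      qed
      ultimately show "\<exists>J :: ('p, 'c, 'd) interp. model J (RuleS ` ?N') \<and>
          (\<forall>\<gamma>\<in>A. sat_fact J \<gamma>) \<and> \<not> sat J (QueryS Q :: ('p, 'v, 'c) sentence)"
        using J by auto
    qed auto
    then show ?thesis by (simp add: Kind_q)
  next
    case Kind_f
    have \<chi>f: "theta \<chi> = cy" "abox0 \<chi> = star_facts \<Sigma> st" "aboxr \<chi> = star_facts \<Sigma> st"
      by (simp_all add: \<chi> Kind_f)
    have r: "Atom Bot [] \<in> aboxr \<chi>" using bot by (simp add: \<chi>f)
    have "entails TYPE('d) (RuleS ` ?N' \<union> FactS ` A) (FactS \<gamma>) \<longleftrightarrow>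
        entails TYPE('d) (RuleS ` N \<union> FactS ` A) (FactS \<gamma>)"
      if \<gamma>: "fact_over \<Sigma> \<gamma>" and A: "abox \<Sigma> A" for \<gamma> A
    proof (rule entails_iff_of_expansion)
      fix I :: "('p, 'c, 'd) interp"
      assume I: "model I (RuleS ` N)" and satA: "\<forall>\<gamma>\<in>A. sat_fact I \<gamma>"
        and n: "\<not> sat I (FactS \<gamma> :: ('p, 'v, 'c) sentence)"
      obtain e p \<pi> D k where
        J: "model (expand \<chi> T I D p \<pi> k :: ('p, 'c, 'd) interp) (RuleS ` ?N')"
        and k: "\<And>c. k c \<in> D \<and> p (k c) = cint I c \<and> \<pi> (k c) = st"
        by (rule model_expand_pairs[OF inf T N I r C(1,2)]) (use C(3) \<chi>f(1) in simp, blast)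
      \<comment> \<open>Since \<open>abox0 \<chi>\<close> and \<open>aboxr \<chi>\<close> coincide,
        agreement on all \<open>\<Sigma>\<close>-facts settles both the ABox and the refuted
        fact.\<close>
      have "sat_fact (expand \<chi> T I D p \<pi> k) \<beta> \<longleftrightarrow> sat_fact I \<beta>" if "fact_over \<Sigma> \<beta>" for \<beta>
      proof -
        have \<beta>: "Atom (psym \<beta>) (replicate (arity (psym \<beta>)) st) \<in> abox0 \<chi>" "wf_atom \<beta>"
          using that star by (auto simp: fact_over_def \<chi>f)
        then have "supported \<chi> T (Atom (psym \<beta>) (replicate (arity (psym \<beta>)) st))"
          by (intro supported_aboxr) (simp add: \<chi>f)
        with sat_fact_expand_star[OF \<beta> k] show ?thesis by blast
      qed
      then show "\<exists>J :: ('p, 'c, 'd) interp. model J (RuleS ` ?N') \<and>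
          (\<forall>\<gamma>\<in>A. sat_fact J \<gamma>) \<and> \<not> sat J (FactS \<gamma> :: ('p, 'v, 'c) sentence)"
        using J satA n A \<gamma> by (auto simp: abox_def)
    qed auto
    then show ?thesis by (simp add: Kind_f)
  next
    case Kind_i
    have \<chi>i: "theta \<chi> = cy" "abox0 \<chi> = pred_facts \<Sigma> cp" "aboxr \<chi> = implication_facts \<Sigma> \<Sigma> cp"
      by (simp_all add: \<chi> Kind_i)
    show ?thesis
      using entails_implication_iff[OF inf T \<chi>i \<Sigma>(2) N]
      by (simp add: Kind_i same_implications_def)
  next
    case Kind_c
    have \<chi>c: "theta \<chi> = cy" "abox0 \<chi> = pred_facts \<Sigma> cp"
      "aboxr \<chi> = implication_facts \<Sigma> (sig T) cp"
      by (simp_all add: \<chi> Kind_c)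
    \<comment> \<open>The relation speaks about the signature of the two compared rule sets, while
      the setting uses that of \<open>T\<close>; inclusion suffices.\<close>
    have "?N' \<union> N \<subseteq> T" using N by (auto simp: module_of_def)
    then have sub: "sig (?N' \<union> N) \<subseteq> sig T" unfolding sig_def by blast
    have "Bot \<in> sig T" using \<Sigma> by blast
    note iff = entails_implication_iff[OF inf T \<chi>c this N]
    show ?thesis
      unfolding Kind_c insep.simps same_implications_def
      using iff subsetD[OF sub] by metis
  qed
qed

theorem theorem15:
  fixes T :: "('p, 'v, 'c) rule set"
    and \<Sigma> :: "'p pred set"
    and cy :: "'v \<Rightarrow> 'c" and cp :: "'p pred \<Rightarrow> nat \<Rightarrow> 'c" and st :: 'c
    and z :: kind
  assumes "infinite (UNIV :: 'd set)"
    and "tbox T"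
    and "\<Sigma> \<subseteq> sig T" and "Bot \<in> \<Sigma>"
    and "fresh_consts T \<Sigma> cy cp st"
  shows "depleting (insep TYPE('d) z \<Sigma>) T (module_of (chi z cy cp st T \<Sigma>) T)"
proof -
  let ?M = "module_of (chi z cy cp st T \<Sigma>) T"
  have M: "?M \<subseteq> T" by (auto simp: module_of_def)
  note insep = insep_module_part[OF assms(1-4) refl]
  have "?M \<union> (T - ?M) = T" using M by blast
  then have "insep TYPE('d) z \<Sigma> T ?M" using insep[OF subset_refl] by metis
  moreover have "insep TYPE('d) z \<Sigma> (T - ?M) {}" using insep[OF empty_subsetI] by simp
  ultimately show ?thesis using M by (simp add: depleting_def is_module_def)
qed

end
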